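(* Let $U:\mathbb R^d\to\mathbb R$ be differentiable, strongly convex, with Lipschitz gradient, and let $h,\gamma>0$. Let $(X_k,V_k)_{k\ge0}$ be the BAOAB chain for $U$ with step size $h$ and friction $\gamma$, with $\xi_k$ the Gaussian variable used in the $k$th step ($k\ge1$). Let $\xi_0\sim\mathcal N(0,\mathrm{Id}_d)$ be independent of $(\xi_k)_{k\ge1}$, or alternatively let $\xi_0$ be the zero vector, and define the auxiliary variable $X_{-1}$ by $$V_0=\frac{2\beta}{(1+\beta)h}(X_0-X_{-1})+\frac{\varsigma}{1+\beta}\,\xi_0-\frac h2\nabla U(X_0).$$ Then, for $k\ge0$, $$X_{k+1}=X_k+\beta(X_k-X_{k-1})-s\nabla U(X_k)+\widetilde\zeta_{k+1},\qquad s=\frac{h^2}{2}(1+\beta),$$ where $$\widetilde\zeta_{k+1}=\frac h2\varsigma\,(\xi_k+\xi_{k+1}).$$ If $\xi_0\sim\mathcal N(0,\mathrm{Id}_d)$, the sequence $(\widetilde\zeta_k)_{k\ge1}$ is a centered stationary $1$-dependent Gaussian sequence with $$\mathbb E[\widetilde\zeta_k\widetilde\zeta_k^\top]=\frac{h^2}{2}(1-\beta^2)\,\mathrm{Id}_d,\qquad \mathbb E[\widetilde\zeta_k\widetilde\zeta_{k+1}^\top]=\frac{h^2}{4}(1-\beta^2)\,\mathrm{Id}_d .$$ If instead $\xi_0=0$, then $\widetilde\zeta_1=\frac h2\varsigma\,\xi_1$ has the smaller covariance $\frac{h^2}{4}(1-\beta^2)\,\mathrm{Id}_d$, while the two displayed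 covariance identities hold from the second update onward (i.e. for $k\ge2$).
   Context: Notation: $\beta=e^{-\gamma h}$, $\varsigma=(1-\beta^2)^{1/2}$. One BAOAB step, driven by a single $\xi\sim\mathcal N(0,\mathrm{Id}_d)$, maps $(x,v)\in\mathbb R^d\times\mathbb R^d$ to $(x^+,v^+)$ by $v^{(a)}=v-\frac h2\nabla U(x)$, $x^{(b)}=x+\frac h2v^{(a)}$, $v^{(c)}=\beta v^{(a)}+\varsigma\xi$, $x^+=x^{(b)}+\frac h2v^{(c)}$, $v^+=v^{(c)}-\frac h2\nabla U(x^+)$. The chain is obtained by iterating with i.i.d. copies $(\xi_k)_{k\ge1}$ of $\xi$. A sequence is $1$-dependent if $(\widetilde\zeta_i)_{i\le k}$ and $(\widetilde\zeta_i)_{i\ge k+2}$ are independent for every $k$. *)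

theory Defs
  imports "HOL-Probability.Probability"
begin

section \<open>The potential\<close>

text \<open>The value is meaningful only where the function is differentiable; \<open>grad_iff\<close> below
  confirms that it is then the gradient.\<close>

definition grad :: "(real^'d \<Rightarrow> real) \<Rightarrow> real^'d \<Rightarrow> real^'d" where
  "grad U x = (THE D. GDERIV U x :> D)"

lemma grad_iff:
  fixes U :: "real^'d \<Rightarrow> real"
  assumes "U differentiable (at x)"
  shows "GDERIV U x :> D \<longleftrightarrow> D = grad U x"
proof -
  obtain F where F: "(U has_derivative F) (at x)"
    using assms unfolding differentiable_def by blast
  interpret F: linear F
    using F has_derivative_linear by blast
  define D0 where "D0 = (\<Sum>b\<in>Basis. F b *\<^sub>R b)"
  have eq: "F w = w \<bullet> D0" for w
  proof -
    have "F w = F (\<Sum>b\<in>Basis. (w \<bullet> b) *\<^sub>R b)"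
      by (simp add: euclidean_representation)
    also have "\<dots> = (\<Sum>b\<in>Basis. (w \<bullet> b) * F b)"
      by (simp add: F.sum F.scaleR)
    finally show ?thesis
      by (simp add: D0_def inner_sum_right mult.commute)
  qed
  have "F = (\<lambda>w. w \<bullet> D0)"
    using eq by (rule ext)
  then have D0: "GDERIV U x :> D0"
    using F unfolding gderiv_def by simp
  have unique: "D' = D0" if "GDERIV U x :> D'" for D'
  proof -
    have "(\<lambda>w. w \<bullet> D') = (\<lambda>w. w \<bullet> D0)"
      using that D0 unfolding gderiv_def by (rule has_derivative_unique)
    then have "w \<bullet> D' = w \<bullet> D0" for w
      by (rule fun_cong)
    then show ?thesis
      using vector_eq_ldot[of D' D0] by blast
  qed
  have "grad U x = D0"
    unfolding grad_def using D0 unique by (rule the_equality)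
  then show ?thesis
    using D0 unique by blast
qed

definition strongly_convex :: "(real^'d \<Rightarrow> real) \<Rightarrow> bool" where
  "strongly_convex U \<longleftrightarrow>
     (\<exists>m>0. \<forall>x y. \<forall>t\<in>{0..1}.
        U ((1 - t) *\<^sub>R x + t *\<^sub>R y)
          \<le> (1 - t) * U x + t * U y - m / 2 * t * (1 - t) * (norm (x - y))\<^sup>2)"

section \<open>The BAOAB chain\<close>

definition baoab_step ::
    "(real^'d \<Rightarrow> real) \<Rightarrow> real \<Rightarrow> real \<Rightarrow> real^'d \<Rightarrow> (real^'d) \<times> (real^'d) \<Rightarrow> (real^'d) \<times> (real^'d)"
  where
  "baoab_step U h \<gamma> \<xi> = (\<lambda>(x, v).
     let \<beta> = exp (- \<gamma> * h);
         \<sigma> = sqrt (1 - \<beta>\<^sup>2);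
         va = v - (h / 2) *\<^sub>R grad U x;
         xb = x + (h / 2) *\<^sub>R va;
         vc = \<beta> *\<^sub>R va + \<sigma> *\<^sub>R \<xi>;
         x' = xb + (h / 2) *\<^sub>R vc;
         v' = vc - (h / 2) *\<^sub>R grad U x'
     in (x', v'))"

definition std_gaussian :: "'w measure \<Rightarrow> ('w \<Rightarrow> real^'d) \<Rightarrow> bool" where
  "std_gaussian M X \<longleftrightarrow>
     distributed M lborel X
       (\<lambda>x. ennreal ((2 * pi) powr (- real CARD('d) / 2) * exp (- (norm x)\<^sup>2 / 2)))"

text \<open>The library's \<open>indep_var\<close> needs two variables with values in a common type, so the families
  \<open>(Y i)\<close>, \<open>i \<in> I\<close>, and \<open>(Y j)\<close>, \<open>j \<in> J\<close>, are both viewed as extensional functions on \<open>nat\<close>.\<close>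

definition indep_families ::
    "'w measure \<Rightarrow> (nat \<Rightarrow> 'w \<Rightarrow> real^'d) \<Rightarrow> nat set \<Rightarrow> nat set \<Rightarrow> bool" where
  "indep_families M Y I J \<longleftrightarrow>
     prob_space.indep_var M
       (Pi\<^sub>M I (\<lambda>_. borel)) (\<lambda>\<omega>. \<lambda>i\<in>I. Y i \<omega>)
       (Pi\<^sub>M J (\<lambda>_. borel)) (\<lambda>\<omega>. \<lambda>j\<in>J. Y j \<omega>)"

text \<open>The pair \<open>(X 0, V 0)\<close> is an arbitrary random initial state; it need not be independent of the
  noise.\<close>

definition baoab_chain ::
    "'w measure \<Rightarrow> (real^'d \<Rightarrow> real) \<Rightarrow> real \<Rightarrow> real \<Rightarrow> (nat \<Rightarrow> 'w \<Rightarrow> real^'d)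
      \<Rightarrow> (nat \<Rightarrow> 'w \<Rightarrow> real^'d) \<Rightarrow> (nat \<Rightarrow> 'w \<Rightarrow> real^'d) \<Rightarrow> bool" where
  "baoab_chain M U h \<gamma> \<xi> X V \<longleftrightarrow>
     (\<forall>k\<ge>1. std_gaussian M (\<xi> k)) \<and> prob_space.indep_vars M (\<lambda>_. borel) \<xi> {1..} \<and>
     X 0 \<in> borel_measurable M \<and> V 0 \<in> borel_measurable M \<and>
     (\<forall>\<omega>\<in>space M. \<forall>k.
        (X (Suc k) \<omega>, V (Suc k) \<omega>) = baoab_step U h \<gamma> (\<xi> (Suc k) \<omega>) (X k \<omega>, V k \<omega>))"

section \<open>Sequences of random vectors indexed by the positive integers\<close>

text \<open>In this section the entry at index 0 is irrelevant.\<close>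

definition centered_seq :: "'w measure \<Rightarrow> (nat \<Rightarrow> 'w \<Rightarrow> real^'d) \<Rightarrow> bool" where
  "centered_seq M Y \<longleftrightarrow> (\<forall>k\<ge>1. has_bochner_integral M (Y k) 0)"

text \<open>Strict stationarity: the law of the whole sequence is shift-invariant.\<close>

definition stationary_seq :: "'w measure \<Rightarrow> (nat \<Rightarrow> 'w \<Rightarrow> real^'d) \<Rightarrow> bool" where
  "stationary_seq M Y \<longleftrightarrow>
     (\<forall>k\<ge>1. Y k \<in> borel_measurable M) \<and>
     (\<forall>m. distr M (Pi\<^sub>M {1..} (\<lambda>_. borel)) (\<lambda>\<omega>. \<lambda>k\<in>{1..}. Y (k + m) \<omega>)
        = distr M (Pi\<^sub>M {1..} (\<lambda>_. borel)) (\<lambda>\<omega>. \<lambda>k\<in>{1..}. Y k \<omega>))"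

definition one_dependent_seq :: "'w measure \<Rightarrow> (nat \<Rightarrow> 'w \<Rightarrow> real^'d) \<Rightarrow> bool" where
  "one_dependent_seq M Y \<longleftrightarrow> (\<forall>k\<ge>1. indep_families M Y {1..k} {k + 2..})"

text \<open>A univariate Gaussian is allowed to be degenerate.\<close>

definition gaussian_rv :: "'w measure \<Rightarrow> ('w \<Rightarrow> real) \<Rightarrow> bool" where
  "gaussian_rv M Z \<longleftrightarrow> Z \<in> borel_measurable M \<and>
     (\<exists>\<mu>. (AE \<omega> in M. Z \<omega> = \<mu>) \<or>
          (\<exists>\<sigma>>0. distributed M lborel Z (\<lambda>x. ennreal (normal_density \<mu> \<sigma> x))))"

text \<open>Joint Gaussianity of all finite subfamilies: every linear functional of finitely many
  entries is Gaussian.\<close>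

definition gaussian_seq :: "'w measure \<Rightarrow> (nat \<Rightarrow> 'w \<Rightarrow> real^'d) \<Rightarrow> bool" where
  "gaussian_seq M Y \<longleftrightarrow>
     (\<forall>J a. finite J \<and> J \<subseteq> {1..} \<longrightarrow> gaussian_rv M (\<lambda>\<omega>. \<Sum>j\<in>J. a j \<bullet> Y j \<omega>))"

section \<open>Covariance matrices\<close>

definition outer :: "real^'d \<Rightarrow> real^'d \<Rightarrow> real^'d^'d" where
  "outer u w = (\<chi> i j. u $ i * w $ j)"

definition has_mixed_moment ::
    "'w measure \<Rightarrow> ('w \<Rightarrow> real^'d) \<Rightarrow> ('w \<Rightarrow> real^'d) \<Rightarrow> real^'d^'d \<Rightarrow> bool" where
  "has_mixed_moment M Y Z C \<longleftrightarrow> has_bochner_integral M (\<lambda>\<omega>. outer (Y \<omega>) (Z \<omega>)) C"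

definition has_covariance :: "'w measure \<Rightarrow> ('w \<Rightarrow> real^'d) \<Rightarrow> real^'d^'d \<Rightarrow> bool" where
  "has_covariance M Y C \<longleftrightarrow> integrable M Y \<and>
     has_mixed_moment M (\<lambda>\<omega>. Y \<omega> - integral\<^sup>L M Y) (\<lambda>\<omega>. Y \<omega> - integral\<^sup>L M Y) C"

text \<open>The strict Loewner order (intended for symmetric matrices).\<close>

definition loewner_less :: "real^'d^'d \<Rightarrow> real^'d^'d \<Rightarrow> bool" where
  "loewner_less A B \<longleftrightarrow> (\<forall>w. w \<noteq> 0 \<longrightarrow> w \<bullet> (A *v w) < w \<bullet> (B *v w))"

end

theory Submission
  imports Defs
begin

text \<open>The velocity can be eliminated from the chain by one observation. Let
  \<open>p\<^sub>k = V\<^sub>k + (h / 2) \<nabla>U(X\<^sub>k)\<close> be the velocity just before the last half kick of step \<open>k\<close>. A BAOAB step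
  gives \<open>X\<^sub>k\<^sub>+\<^sub>1 = X\<^sub>k + (h / 2) (1 + \<beta>) p\<^sub>k - s \<nabla>U(X\<^sub>k) + c \<xi>\<^sub>k\<^sub>+\<^sub>1\<close> with \<open>c = (h / 2) \<sigma>\<close>, and it also
  expresses the momentum term by positions alone, up to the noise of the same step:
  \<open>(h / 2) (1 + \<beta>) p\<^sub>k = \<beta> (X\<^sub>k - X\<^sub>k\<^sub>-\<^sub>1) + c \<xi>\<^sub>k\<close>. Inserting the second identity into the first yields the
  recursion, in which every \<open>\<xi>\<^sub>k\<close> enters twice; the auxiliary variable \<open>X\<^sub>-\<^sub>1\<close> is chosen so that the second
  identity also holds for \<open>k = 0\<close>. Lemma \<open>baoab_step_position_and_noise\<close> contains both identities.

  The remaining claims concern the moving average \<open>c (\<xi>\<^sub>k\<^sub>-\<^sub>1 + \<xi>\<^sub>k)\<close> of independent standard Gaussian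
  vectors. The Gaussian density is a product over the coordinates, so the coordinates of a standard
  Gaussian vector are independent standard normal variables. This gives the covariance \<open>mat 1\<close> and, as
  sums of independent normal variables are normal, joint Gaussianity
  (\<open>gaussian_moving_average\<close>). The covariances of the moving average follow by bilinearity: two
  shared noise vectors contribute \<open>2 c\<^sup>2\<close>, one contributes \<open>c\<^sup>2\<close>. This covers the case \<open>\<xi>\<^sub>0 = 0\<close>, where
  the first entry contains a single noise vector and all others are averages of two Gaussian ones.

  If \<open>\<xi>\<^sub>0\<close> is Gaussian as well, the whole sequence of noise vectors is independent and identically
  distributed. The moving average is a fixed measurable
  function of the noise sequence that commutes with shifts, so it inherits stationarity from the product
  law of the noise (\<open>stationary_moving_average\<close>). The entries up to \<open>k\<close> use the noise up to \<open>k\<close>, and the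
  entries from \<open>k + 2\<close> on use the noise from \<open>k + 1\<close> on, whence one-dependence
  (\<open>one_dependent_moving_average\<close>).\<close>

section \<open>Eliminating the velocity from a BAOAB step\<close>

text \<open>The variables \<open>p\<close> and \<open>p'\<close> are the velocities before the closing half kick of the previous and of the
  present step. In terms of them the two half kicks at \<open>x\<close> merge into a full one, so the gradient occurs
  only at \<open>x\<close>. The second identity comes from \<open>p' = \<beta> v\<^sub>a + \<sigma> \<xi>\<close> and
  \<open>x' - x = (h / 2) ((1 + \<beta>) v\<^sub>a + \<sigma> \<xi>)\<close>, where \<open>v\<^sub>a\<close> is the velocity after the opening half kick; the noise
  is left over with the factor \<open>(1 + \<beta>) - \<beta> = 1\<close>.\<close>

lemma baoab_step_position_and_noise:
  fixes x v \<xi> :: "real^'d"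
  assumes step: "(x', v') = baoab_step U h \<gamma> \<xi> (x, v)"
    and \<beta>: "\<beta> = exp (- \<gamma> * h)" and \<sigma>: "\<sigma> = sqrt (1 - \<beta>\<^sup>2)" and s: "s = h\<^sup>2 / 2 * (1 + \<beta>)"
  defines "p \<equiv> v + (h / 2) *\<^sub>R grad U x" and "p' \<equiv> v' + (h / 2) *\<^sub>R grad U x'"
  shows "x' = x + (h / 2 * (1 + \<beta>)) *\<^sub>R p - s *\<^sub>R grad U x + (h / 2 * \<sigma>) *\<^sub>R \<xi>"
    and "(h / 2 * (1 + \<beta>)) *\<^sub>R p' = \<beta> *\<^sub>R (x' - x) + (h / 2 * \<sigma>) *\<^sub>R \<xi>"
proof -
  define g where "g = grad U x"
  define g' where "g' = grad U x'"
  have x': "x' = x + (h / 2) *\<^sub>R (v - (h / 2) *\<^sub>R g)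
      + (h / 2) *\<^sub>R (\<beta> *\<^sub>R (v - (h / 2) *\<^sub>R g) + \<sigma> *\<^sub>R \<xi>)"
    using step unfolding baoab_step_def by (simp add: Let_def g_def \<sigma> \<beta>)
  have v': "v' = \<beta> *\<^sub>R (v - (h / 2) *\<^sub>R g) + \<sigma> *\<^sub>R \<xi> - (h / 2) *\<^sub>R g'"
    using step unfolding baoab_step_def g'_def by (auto simp: Let_def g_def \<sigma> \<beta>)
  show *: "x' = x + (h / 2 * (1 + \<beta>)) *\<^sub>R p - s *\<^sub>R grad U x + (h / 2 * \<sigma>) *\<^sub>R \<xi>"
    unfolding p_def g_def[symmetric] x' s
    by (simp add: vec_eq_iff power2_eq_square field_simps)
  have p': "p' = \<beta> *\<^sub>R (v - (h / 2) *\<^sub>R g) + \<sigma> *\<^sub>R \<xi>"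
    unfolding p'_def v' g'_def by simp
  show "(h / 2 * (1 + \<beta>)) *\<^sub>R p' = \<beta> *\<^sub>R (x' - x) + (h / 2 * \<sigma>) *\<^sub>R \<xi>"
    unfolding p' x'
    by (simp add: vec_eq_iff power2_eq_square field_simps)
qed

section \<open>Standard Gaussian vectors\<close>

lemma std_gaussian_measurable:
  "std_gaussian M X \<Longrightarrow> X \<in> borel_measurable M"
  unfolding std_gaussian_def by (auto dest: distributed_measurable)

lemma std_gaussian_density_eq_prod:
  fixes x :: "real^'d"
  shows "(2 * pi) powr (- real CARD('d) / 2) * exp (- (norm x)\<^sup>2 / 2)
       = (\<Prod>b\<in>Basis. std_normal_density (x \<bullet> b))"
proof -
  have "(\<Prod>b\<in>(Basis :: (real^'d) set). std_normal_density (x \<bullet> b))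
      = (1 / sqrt (2 * pi)) ^ CARD('d) * exp (\<Sum>b\<in>Basis. - (x \<bullet> b)\<^sup>2 / 2)"
    by (simp add: std_normal_density_def prod.distrib exp_sum power_one_over prod_dividef)
  also have "(\<Sum>b\<in>Basis. - (x \<bullet> b)\<^sup>2 / 2) = - (norm x)\<^sup>2 / 2"
    unfolding sum_divide_distrib[symmetric] sum_negf power2_norm_eq_inner euclidean_inner[of x x]
    by (simp add: power2_eq_square)
  also have "(1 / sqrt (2 * pi)) ^ CARD('d) = (2 * pi) powr (- real CARD('d) / 2)"
  proof -
    have "1 / sqrt (2 * pi) = (2 * pi) powr (- 1 / 2)"
      by (subst powr_half_sqrt[symmetric]) (simp_all only: minus_divide_left[symmetric] powr_minus_divide, simp)
    then show ?thesis
      by (simp only:) (subst powr_power, simp_all add: mult.commute)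
  qed
  finally show ?thesis by simp
qed

text \<open>The density and the indicator of a box are both products over the coordinates, so Fubini's theorem
  for \<open>lborel\<close> factorises the integral. Both the laws and the independence of the coordinates are read
  off from this formula.\<close>

lemma std_gaussian_emeasure_coordinates:
  fixes X :: "'w \<Rightarrow> real^'d"
  assumes X: "std_gaussian M X" and A: "\<And>b. b \<in> Basis \<Longrightarrow> A b \<in> sets borel"
  shows "emeasure M {\<omega> \<in> space M. \<forall>b\<in>Basis. X \<omega> \<bullet> b \<in> A b}
       = (\<Prod>b\<in>Basis. \<integral>\<^sup>+ t. ennreal (std_normal_density t) * indicator (A b) t \<partial>lborel)"
proof -
  let ?B = "{x::real^'d. \<forall>b\<in>Basis. x \<bullet> b \<in> A b}"
  have "?B = (\<Inter>b\<in>Basis. (\<lambda>x. x \<bullet> b) -` A b \<inter> space borel)"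
    by auto
  also have "\<dots> \<in> sets borel"
    by (intro sets.finite_INT measurable_sets[OF _ A]) auto
  finally have B: "?B \<in> sets lborel" by simp
  have ind: "indicator ?B x = (\<Prod>b\<in>Basis. indicator (A b) (x \<bullet> b) :: ennreal)" for x :: "real^'d"
  proof (cases "\<forall>b\<in>Basis. x \<bullet> b \<in> A b")
    case False
    then obtain b where "b \<in> Basis" "x \<bullet> b \<notin> A b" by blast
    then have "(\<Prod>b\<in>Basis. indicator (A b) (x \<bullet> b) :: ennreal) = 0"
      by (intro prod_zero) (auto intro!: bexI[of _ b])
    with False show ?thesis by simp
  qed simp
  have "emeasure M {\<omega> \<in> space M. \<forall>b\<in>Basis. X \<omega> \<bullet> b \<in> A b} = emeasure M (X -` ?B \<inter> space M)"
    by (intro arg_cong[where f="emeasure M"]) auto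
  also have "\<dots> = (\<integral>\<^sup>+ x. ennreal (\<Prod>b\<in>Basis. std_normal_density (x \<bullet> b)) * indicator ?B x \<partial>lborel)"
    using distributed_emeasure[OF X[unfolded std_gaussian_def std_gaussian_density_eq_prod] B] .
  also have "\<dots> = (\<integral>\<^sup>+ x. (\<Prod>b\<in>(Basis::(real^'d) set).
      ennreal (std_normal_density (x \<bullet> b)) * indicator (A b) (x \<bullet> b)) \<partial>lborel)"
    by (simp add: ind prod.distrib prod_ennreal)
  also have "\<dots> = (\<Prod>b\<in>Basis. \<integral>\<^sup>+ t. ennreal (std_normal_density t) * indicator (A b) t \<partial>lborel)"
    using A by (intro nn_integral_lborel_prod) auto
  finally show ?thesis .
qed

lemma nn_integral_std_normal_density: "(\<integral>\<^sup>+ t. std_normal_density t \<partial>lborel) = 1"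
  using nn_integral_eq_integral[of lborel "std_normal_density"] by simp

lemma std_gaussian_coordinate:
  fixes X :: "'w \<Rightarrow> real^'d"
  assumes X: "std_gaussian M X" and b: "b \<in> Basis"
  shows "distributed M lborel (\<lambda>\<omega>. X \<omega> \<bullet> b) std_normal_density"
proof -
  have [measurable]: "X \<in> borel_measurable M"
    using X by (rule std_gaussian_measurable)
  have "emeasure M ((\<lambda>\<omega>. X \<omega> \<bullet> b) -` A \<inter> space M)
      = (\<integral>\<^sup>+ t. ennreal (std_normal_density t) * indicator A t \<partial>lborel)" if A: "A \<in> sets borel" for A
  proof -
    have "(\<lambda>\<omega>. X \<omega> \<bullet> b) -` A \<inter> space M
        = {\<omega> \<in> space M. \<forall>c\<in>Basis. X \<omega> \<bullet> c \<in> (if c = b then A else UNIV)}"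
      using b by auto
    also have "emeasure M \<dots> = (\<Prod>c\<in>(Basis::(real^'d) set).
        \<integral>\<^sup>+ t. ennreal (std_normal_density t) * indicator (if c = b then A else UNIV) t \<partial>lborel)"
      using X by (rule std_gaussian_emeasure_coordinates) (simp add: A)
    also have "\<dots> = (\<Prod>c\<in>(Basis::(real^'d) set).
        if c = b then \<integral>\<^sup>+ t. ennreal (std_normal_density t) * indicator A t \<partial>lborel else 1)"
      by (intro prod.cong) (simp_all add: nn_integral_std_normal_density)
    finally show ?thesis
      using b by (simp add: prod.delta)
  qed
  then show ?thesis
    unfolding distributed_def by (auto intro!: measure_eqI simp: emeasure_distr emeasure_density)
qed

lemma (in prob_space) std_gaussian_coordinates_indep:
  fixes X :: "'a \<Rightarrow> real^'d"
  assumes X: "std_gaussian M X"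
  shows "indep_vars (\<lambda>_. borel) (\<lambda>b \<omega>. X \<omega> \<bullet> b) Basis"
proof -
  have [measurable]: "X \<in> borel_measurable M"
    using X by (rule std_gaussian_measurable)
  have "prob (\<Inter>b\<in>Basis. (\<lambda>\<omega>. X \<omega> \<bullet> b) -` A b \<inter> space M)
      = (\<Prod>b\<in>Basis. prob ((\<lambda>\<omega>. X \<omega> \<bullet> b) -` A b \<inter> space M))"
    if A: "\<And>b. b \<in> Basis \<Longrightarrow> A b \<in> sets borel" for A
  proof -
    have "(\<Inter>b\<in>Basis. (\<lambda>\<omega>. X \<omega> \<bullet> b) -` A b \<inter> space M)
        = {\<omega> \<in> space M. \<forall>b\<in>Basis. X \<omega> \<bullet> b \<in> A b}"
      by auto
    then have "emeasure M (\<Inter>b\<in>Basis. (\<lambda>\<omega>. X \<omega> \<bullet> b) -` A b \<inter> space M)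
        = (\<Prod>b\<in>Basis. emeasure M ((\<lambda>\<omega>. X \<omega> \<bullet> b) -` A b \<inter> space M))"
      using std_gaussian_emeasure_coordinates[OF X, of A] A
        distributed_emeasure[OF std_gaussian_coordinate[OF X]] by simp
    then show ?thesis
      by (simp add: emeasure_eq_measure prod_ennreal prod_nonneg)
  qed
  then show ?thesis
    by (subst indep_vars_finite[where E="\<lambda>_. sets borel"])
       (auto simp: sets.Int_stable sets.sigma_sets_eq[of borel, simplified] Pi_iff)
qed

section \<open>Gaussian random variables\<close>

text \<open>The class \<open>gaussian_rv\<close> contains the almost surely constant variables, and linear functionals do
  produce them when coefficients vanish. The following lemmas extend the closure properties of the normal
  densities to this class.\<close>

lemma gaussian_rv_cong_AE:
  assumes "gaussian_rv M Z" and Z'[measurable]: "Z' \<in> borel_measurable M"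
    and eq: "AE \<omega> in M. Z \<omega> = Z' \<omega>"
  shows "gaussian_rv M Z'"
proof -
  have Z[measurable]: "Z \<in> borel_measurable M"
    using assms by (simp add: gaussian_rv_def)
  have "distributed M lborel Z' f" if "distributed M lborel Z f" for f
    using that distr_cong_AE[OF refl refl eq, of lborel] unfolding distributed_def by simp
  moreover have "AE \<omega> in M. Z' \<omega> = \<mu>" if "AE \<omega> in M. Z \<omega> = \<mu>" for \<mu>
    using that eq by eventually_elim simp
  moreover obtain \<mu> where "(AE \<omega> in M. Z \<omega> = \<mu>) \<or> (\<exists>\<sigma>>0. distributed M lborel Z (normal_density \<mu> \<sigma>))"
    using assms(1) by (auto simp: gaussian_rv_def)
  ultimately have "(AE \<omega> in M. Z' \<omega> = \<mu>) \<or> (\<exists>\<sigma>>0. distributed M lborel Z' (normal_density \<mu> \<sigma>))"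
    by blast
  then show ?thesis
    using Z' unfolding gaussian_rv_def by (intro conjI exI[of _ \<mu>])
qed

lemma gaussian_rv_degenerate:
  assumes "AE \<omega> in M. Z \<omega> = \<mu>" "Z \<in> borel_measurable M"
  shows "gaussian_rv M Z"
  unfolding gaussian_rv_def using assms by (intro conjI exI[of _ \<mu>] disjI1)

lemma gaussian_rv_normal:
  assumes "distributed M lborel Z (normal_density \<mu> \<sigma>)" "\<sigma> > 0"
  shows "gaussian_rv M Z"
  unfolding gaussian_rv_def using assms distributed_measurable[OF assms(1)]
  by (intro conjI exI[of _ \<mu>] disjI2 exI[of _ \<sigma>]) auto

lemma gaussian_rv_const: "gaussian_rv M (\<lambda>_. c)"
  by (rule gaussian_rv_degenerate[where \<mu>=c]) simp_all

lemma (in prob_space) gaussian_rv_affine: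
  assumes "gaussian_rv M Z"
  shows "gaussian_rv M (\<lambda>\<omega>. c + a * Z \<omega>)"
proof (cases "a = 0")
  case False
  have [measurable]: "Z \<in> borel_measurable M"
    using assms by (simp add: gaussian_rv_def)
  obtain \<mu> where "(AE \<omega> in M. Z \<omega> = \<mu>) \<or> (\<exists>\<sigma>>0. distributed M lborel Z (normal_density \<mu> \<sigma>))"
    using assms by (auto simp: gaussian_rv_def)
  then show ?thesis
  proof
    assume "AE \<omega> in M. Z \<omega> = \<mu>"
    then have "AE \<omega> in M. c + a * Z \<omega> = c + a * \<mu>"
      by eventually_elim simp
    then show ?thesis
      by (rule gaussian_rv_degenerate) simp
  next
    assume "\<exists>\<sigma>>0. distributed M lborel Z (normal_density \<mu> \<sigma>)"
    then obtain \<sigma> where "\<sigma> > 0" and Z: "distributed M lborel Z (normal_density \<mu> \<sigma>)"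
      by blast
    then have "distributed M lborel (\<lambda>\<omega>. c + a * Z \<omega>) (normal_density (c + a * \<mu>) (\<bar>a\<bar> * \<sigma>))"
      using False by (intro normal_density_affine) auto
    moreover have "\<bar>a\<bar> * \<sigma> > 0"
      using False \<open>\<sigma> > 0\<close> by simp
    ultimately show ?thesis
      by (rule gaussian_rv_normal)
  qed
qed (simp add: gaussian_rv_const)

text \<open>The almost surely constant summands have no density and are split off first; their sum merely
  translates the sum of the others, which is normal by convolution.\<close>

lemma (in prob_space) gaussian_rv_sum_indep:
  assumes fin: "finite I" and indep: "indep_vars (\<lambda>_. borel) Z I"
    and gauss: "\<And>i. i \<in> I \<Longrightarrow> gaussian_rv M (Z i)"
  shows "gaussian_rv M (\<lambda>\<omega>. \<Sum>i\<in>I. Z i \<omega>)"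
proof -
  have [measurable]: "Z i \<in> borel_measurable M" if "i \<in> I" for i
    using gauss[OF that] by (simp add: gaussian_rv_def)
  define N where "N = {i \<in> I. \<exists>\<mu> \<sigma>. \<sigma> > 0 \<and> distributed M lborel (Z i) (normal_density \<mu> \<sigma>)}"
  have N: "finite N" "N \<subseteq> I"
    using fin by (auto simp: N_def)
  have "\<forall>i\<in>N. \<exists>\<mu> \<sigma>. \<sigma> > 0 \<and> distributed M lborel (Z i) (normal_density \<mu> \<sigma>)"
    by (auto simp: N_def)
  then obtain \<mu> \<sigma> where \<mu>\<sigma>: "\<And>i. i \<in> N \<Longrightarrow> \<sigma> i > 0"
      "\<And>i. i \<in> N \<Longrightarrow> distributed M lborel (Z i) (normal_density (\<mu> i) (\<sigma> i))"
    by metis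
  have gauss_N: "gaussian_rv M (\<lambda>\<omega>. \<Sum>i\<in>N. Z i \<omega>)"
  proof (cases "N = {}")
    case False
    then have "distributed M lborel (\<lambda>\<omega>. \<Sum>i\<in>N. Z i \<omega>)
        (normal_density (\<Sum>i\<in>N. \<mu> i) (sqrt (\<Sum>i\<in>N. (\<sigma> i)\<^sup>2)))"
      using N \<mu>\<sigma> by (intro sum_indep_normal indep_vars_subset[OF indep]) auto
    moreover have "sqrt (\<Sum>i\<in>N. (\<sigma> i)\<^sup>2) > 0"
      using N False \<mu>\<sigma>(1) by (intro real_sqrt_gt_zero sum_pos zero_less_power) auto
    ultimately show ?thesis
      by (rule gaussian_rv_normal)
  qed (simp add: gaussian_rv_const)
  have "\<forall>i\<in>I - N. \<exists>c. AE \<omega> in M. Z i \<omega> = c"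
    using gauss unfolding gaussian_rv_def N_def by blast
  then obtain c where c: "\<And>i. i \<in> I - N \<Longrightarrow> AE \<omega> in M. Z i \<omega> = c i"
    by metis
  have "AE \<omega> in M. \<forall>i\<in>I - N. Z i \<omega> = c i"
    using fin c by (intro AE_finite_allI) auto
  then have "AE \<omega> in M. (\<Sum>i\<in>I - N. c i) + 1 * (\<Sum>i\<in>N. Z i \<omega>) = (\<Sum>i\<in>I. Z i \<omega>)"
  proof eventually_elim
    case (elim \<omega>)
    then show ?case
      using sum.subset_diff[OF N(2) fin, of "\<lambda>i. Z i \<omega>"] by simp
  qed
  then show ?thesis
    by (rule gaussian_rv_cong_AE[OF gaussian_rv_affine[OF gauss_N], rotated]) simp
qed

lemma (in prob_space) std_gaussian_inner_gaussian_rv: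
  fixes X :: "'a \<Rightarrow> real^'d"
  assumes X: "std_gaussian M X"
  shows "gaussian_rv M (\<lambda>\<omega>. u \<bullet> X \<omega>)"
proof -
  have [measurable]: "X \<in> borel_measurable M"
    using X by (rule std_gaussian_measurable)
  have coord: "gaussian_rv M (\<lambda>\<omega>. X \<omega> \<bullet> b)" if "b \<in> Basis" for b
    using std_gaussian_coordinate[OF X that] by (rule gaussian_rv_normal) simp
  have "indep_vars (\<lambda>_. borel) (\<lambda>b \<omega>. 0 + (u \<bullet> b) * (X \<omega> \<bullet> b)) Basis"
    by (rule indep_vars_compose2[OF std_gaussian_coordinates_indep[OF X]]) simp
  then have "gaussian_rv M (\<lambda>\<omega>. \<Sum>b\<in>Basis. 0 + (u \<bullet> b) * (X \<omega> \<bullet> b))"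
    by (rule gaussian_rv_sum_indep[OF finite_Basis]) (rule gaussian_rv_affine[OF coord])
  then show ?thesis
    by (subst euclidean_inner) simp
qed

section \<open>Mixed moments\<close>

text \<open>A matrix is the sum of its entries placed into otherwise vanishing matrices, and the placement maps
  are bounded and linear, so the Bochner integral of a matrix may be computed entrywise.\<close>

lemma has_mixed_momentI:
  fixes Y Z :: "'w \<Rightarrow> real^'d"
  assumes "\<And>i j. has_bochner_integral M (\<lambda>\<omega>. Y \<omega> $ i * Z \<omega> $ j) (C $ i $ j)"
  shows "has_mixed_moment M Y Z C"
proof -
  define E :: "'d \<Rightarrow> 'd \<Rightarrow> real \<Rightarrow> real^'d^'d" where "E i j t = axis i (axis j t)" for i j t
  have E_nth: "E i j t $ k $ l = (if k = i \<and> l = j then t else 0)" for i j k l t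
    by (simp add: E_def axis_def)
  have "linear (E i j)" for i j
    by (intro linearI) (simp_all add: vec_eq_iff E_nth)
  then have E: "bounded_linear (E i j)" for i j
    by (simp add: linear_conv_bounded_linear)
  have expand: "A = (\<Sum>i\<in>UNIV. \<Sum>j\<in>UNIV. E i j (A $ i $ j))" for A :: "real^'d^'d"
  proof -
    have "(\<Sum>i\<in>UNIV. \<Sum>j\<in>UNIV. E i j (A $ i $ j)) $ k $ l = A $ k $ l" for k l
    proof -
      have "(\<Sum>j\<in>UNIV. E i j (A $ i $ j)) $ k $ l = (if i = k then A $ i $ l else 0)" for i
        by (cases "i = k") (simp_all add: E_nth)
      then show ?thesis by simp
    qed
    then show ?thesis by (simp add: vec_eq_iff)
  qed
  have "has_bochner_integral M (\<lambda>\<omega>. \<Sum>i\<in>UNIV. \<Sum>j\<in>UNIV. E i j (Y \<omega> $ i * Z \<omega> $ j))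
      (\<Sum>i\<in>UNIV. \<Sum>j\<in>UNIV. E i j (C $ i $ j))"
    by (intro has_bochner_integral_sum has_bochner_integral_bounded_linear[OF E] assms)
  moreover have "(\<Sum>i\<in>UNIV. \<Sum>j\<in>UNIV. E i j (Y \<omega> $ i * Z \<omega> $ j)) = outer (Y \<omega>) (Z \<omega>)" for \<omega>
    by (subst expand[of "outer _ _"]) (simp add: outer_def)
  ultimately show ?thesis
    unfolding has_mixed_moment_def by (simp flip: expand)
qed

lemma has_mixed_moment_cong:
  assumes "\<And>\<omega>. \<omega> \<in> space M \<Longrightarrow> Y \<omega> = Y' \<omega>" "\<And>\<omega>. \<omega> \<in> space M \<Longrightarrow> Z \<omega> = Z' \<omega>"
  shows "has_mixed_moment M Y Z C \<longleftrightarrow> has_mixed_moment M Y' Z' C"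
  unfolding has_mixed_moment_def by (rule has_bochner_integral_cong) (simp_all add: assms)

lemma has_mixed_moment_scaled_sums:
  fixes Y1 Y2 Z1 Z2 :: "'w \<Rightarrow> real^'d"
  assumes "has_mixed_moment M Y1 Z1 A" "has_mixed_moment M Y1 Z2 B"
    and "has_mixed_moment M Y2 Z1 C" "has_mixed_moment M Y2 Z2 D"
  shows "has_mixed_moment M (\<lambda>\<omega>. c *\<^sub>R (Y1 \<omega> + Y2 \<omega>)) (\<lambda>\<omega>. c *\<^sub>R (Z1 \<omega> + Z2 \<omega>))
    (c\<^sup>2 *\<^sub>R (A + B + C + D))"
proof -
  have "has_bochner_integral M
      (\<lambda>\<omega>. c\<^sup>2 *\<^sub>R (outer (Y1 \<omega>) (Z1 \<omega>) + outer (Y1 \<omega>) (Z2 \<omega>) + outer (Y2 \<omega>) (Z1 \<omega>) + outer (Y2 \<omega>) (Z2 \<omega>)))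
      (c\<^sup>2 *\<^sub>R (A + B + C + D))"
    using assms unfolding has_mixed_moment_def
    by (intro has_bochner_integral_scaleR_right has_bochner_integral_add) auto
  moreover have "c\<^sup>2 *\<^sub>R (outer u w + outer u w' + outer u' w + outer u' w')
      = outer (c *\<^sub>R (u + u')) (c *\<^sub>R (w + w'))" for u u' w w' :: "real^'d"
    by (simp add: vec_eq_iff outer_def power2_eq_square algebra_simps)
  ultimately show ?thesis
    unfolding has_mixed_moment_def by simp
qed

lemma loewner_less_scaled_identity:
  assumes "a < b"
  shows "loewner_less (a *\<^sub>R mat 1 :: real^'d^'d) (b *\<^sub>R mat 1)"
  unfolding loewner_less_def
proof (intro allI impI)
  fix w :: "real^'d" assume "w \<noteq> 0"
  then have "a * (w \<bullet> w) < b * (w \<bullet> w)"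
    using assms by (intro mult_strict_right_mono) auto
  then show "w \<bullet> ((a *\<^sub>R mat 1) *v w) < w \<bullet> ((b *\<^sub>R mat 1) *v w)"
    by (simp add: scaleR_matrix_vector_assoc[symmetric])
qed

lemma has_mixed_moment_scale:
  fixes Y Z :: "'w \<Rightarrow> real^'d"
  assumes "has_mixed_moment M Y Z C"
  shows "has_mixed_moment M (\<lambda>\<omega>. c *\<^sub>R Y \<omega>) (\<lambda>\<omega>. c *\<^sub>R Z \<omega>) (c\<^sup>2 *\<^sub>R C)"
proof -
  have "outer (c *\<^sub>R u) (c *\<^sub>R w) = c\<^sup>2 *\<^sub>R outer u w" for u w :: "real^'d"
    by (simp add: vec_eq_iff outer_def power2_eq_square)
  then show ?thesis
    using assms unfolding has_mixed_moment_def by (simp add: has_bochner_integral_scaleR_right)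
qed

lemma std_gaussian_coordinate_moments:
  fixes X :: "'w \<Rightarrow> real^'d"
  assumes X: "std_gaussian M X"
  shows "has_bochner_integral M (\<lambda>\<omega>. X \<omega> $ i) 0"
    and "has_bochner_integral M (\<lambda>\<omega>. X \<omega> $ i * X \<omega> $ i) 1"
proof -
  have D: "distributed M lborel (\<lambda>\<omega>. X \<omega> $ i) std_normal_density"
    using std_gaussian_coordinate[OF X, of "axis i 1"] by (simp add: cart_eq_inner_axis)
  show "has_bochner_integral M (\<lambda>\<omega>. X \<omega> $ i) 0"
    using std_normal_moment_odd[of 0] distributed_integrable[OF D, of "\<lambda>x. x"]
      distributed_integral[OF D, of "\<lambda>x. x"]
    by (simp add: has_bochner_integral_iff)
  show "has_bochner_integral M (\<lambda>\<omega>. X \<omega> $ i * X \<omega> $ i) 1"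
    using std_normal_moment_even[of 1] distributed_integrable[OF D, of "\<lambda>x. x * x"]
      distributed_integral[OF D, of "\<lambda>x. x * x"]
    by (simp add: has_bochner_integral_iff power2_eq_square)
qed

lemma std_gaussian_mean:
  fixes X :: "'w \<Rightarrow> real^'d"
  assumes X: "std_gaussian M X"
  shows "has_bochner_integral M X 0"
proof -
  have "has_bochner_integral M (\<lambda>\<omega>. \<Sum>i\<in>UNIV. (X \<omega> $ i) *\<^sub>R axis i 1)
      (\<Sum>i\<in>UNIV. 0 *\<^sub>R (axis i 1 :: real^'d))"
    by (intro has_bochner_integral_sum has_bochner_integral_scaleR_left
        std_gaussian_coordinate_moments(1)[OF X])
  moreover have "(\<Sum>i\<in>UNIV. (X \<omega> $ i) *\<^sub>R axis i 1) = X \<omega>" for \<omega>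
    using basis_expansion[of "X \<omega>"] by (simp add: scalar_mult_eq_scaleR)
  ultimately show ?thesis by simp
qed

lemma (in prob_space) indep_vars_mult_mean_zero:
  fixes Z :: "'i \<Rightarrow> 'a \<Rightarrow> real"
  assumes indep: "indep_vars (\<lambda>_. borel) Z I" and ij: "i \<in> I" "j \<in> I" "i \<noteq> j"
    and Z: "has_bochner_integral M (Z i) 0" "has_bochner_integral M (Z j) 0"
  shows "has_bochner_integral M (\<lambda>\<omega>. Z i \<omega> * Z j \<omega>) 0"
proof -
  have indep': "indep_vars (\<lambda>_. borel) Z {i, j}"
    using indep by (rule indep_vars_subset) (use ij in auto)
  have int: "integrable M (Z k)" if "k \<in> {i, j}" for k
    using that Z by (auto simp: has_bochner_integral_iff)
  show ?thesis
    using indep_vars_integrable[OF _ indep' int] indep_vars_lebesgue_integral[OF _ indep' int] ij(3) Z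
    by (simp add: has_bochner_integral_iff)
qed

lemma (in prob_space) std_gaussian_second_moment:
  fixes X :: "'a \<Rightarrow> real^'d"
  assumes X: "std_gaussian M X"
  shows "has_mixed_moment M X X (mat 1)"
proof (rule has_mixed_momentI)
  fix i j :: 'd
  show "has_bochner_integral M (\<lambda>\<omega>. X \<omega> $ i * X \<omega> $ j) (mat 1 $ i $ j)"
  proof (cases "i = j")
    case False
    have "has_bochner_integral M (\<lambda>\<omega>. (X \<omega> \<bullet> axis i 1) * (X \<omega> \<bullet> axis j 1)) 0"
      by (rule indep_vars_mult_mean_zero[OF std_gaussian_coordinates_indep[OF X]])
         (use False std_gaussian_coordinate_moments(1)[OF X] in
           \<open>simp_all add: axis_eq_axis flip: cart_eq_inner_axis\<close>)
    with False show ?thesis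
      by (simp add: mat_def flip: cart_eq_inner_axis)
  qed (simp add: mat_def std_gaussian_coordinate_moments(2)[OF X])
qed

lemma (in prob_space) indep_std_gaussian_mixed_moment:
  fixes \<xi> :: "'i \<Rightarrow> 'a \<Rightarrow> real^'d"
  assumes indep: "indep_vars (\<lambda>_. borel) \<xi> I" and gauss: "\<And>i. i \<in> I \<Longrightarrow> std_gaussian M (\<xi> i)"
    and ab: "a \<in> I" "b \<in> I"
  shows "has_mixed_moment M (\<xi> a) (\<xi> b) (if a = b then mat 1 else 0)"
proof (cases "a = b")
  case False
  have "has_bochner_integral M (\<lambda>\<omega>. \<xi> a \<omega> $ i * \<xi> b \<omega> $ j) 0" for i j
  proof -
    \<comment> \<open>A single family of scalar variables that contains both factors.\<close>
    let ?Z = "\<lambda>k \<omega>. \<xi> k \<omega> $ (if k = a then i else j)"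
    have "indep_vars (\<lambda>_. borel) ?Z I"
      by (rule indep_vars_compose2[OF indep, where Y="\<lambda>k x. x $ (if k = a then i else j)"]) simp
    then have "has_bochner_integral M (\<lambda>\<omega>. ?Z a \<omega> * ?Z b \<omega>) 0"
      by (rule indep_vars_mult_mean_zero[OF _ ab False])
         (rule std_gaussian_coordinate_moments(1)[OF gauss], fact)+
    with False show ?thesis by simp
  qed
  with False show ?thesis
    by (auto intro!: has_mixed_momentI)
qed (simp add: std_gaussian_second_moment gauss ab)

lemma (in prob_space) moving_average_mixed_moments:
  fixes \<xi> :: "nat \<Rightarrow> 'a \<Rightarrow> real^'d"
  assumes indep: "indep_vars (\<lambda>_. borel) \<xi> {n..}" and gauss: "\<And>i. i \<ge> n \<Longrightarrow> std_gaussian M (\<xi> i)"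
  shows "has_mixed_moment M (\<lambda>\<omega>. c *\<^sub>R (\<xi> n \<omega> + \<xi> (Suc n) \<omega>)) (\<lambda>\<omega>. c *\<^sub>R (\<xi> n \<omega> + \<xi> (Suc n) \<omega>))
      ((2 * c\<^sup>2) *\<^sub>R mat 1)"
    and "has_mixed_moment M (\<lambda>\<omega>. c *\<^sub>R (\<xi> n \<omega> + \<xi> (Suc n) \<omega>))
      (\<lambda>\<omega>. c *\<^sub>R (\<xi> (Suc n) \<omega> + \<xi> (Suc (Suc n)) \<omega>)) (c\<^sup>2 *\<^sub>R mat 1)"
proof -
  have m: "has_mixed_moment M (\<xi> a) (\<xi> b) (if a = b then mat 1 else 0)" if "a \<ge> n" "b \<ge> n" for a b
    using that gauss by (intro indep_std_gaussian_mixed_moment[OF indep]) auto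
  show "has_mixed_moment M (\<lambda>\<omega>. c *\<^sub>R (\<xi> n \<omega> + \<xi> (Suc n) \<omega>)) (\<lambda>\<omega>. c *\<^sub>R (\<xi> n \<omega> + \<xi> (Suc n) \<omega>))
      ((2 * c\<^sup>2) *\<^sub>R mat 1)"
    using has_mixed_moment_scaled_sums[OF m[of n n] m[of n "Suc n"] m[of "Suc n" n] m[of "Suc n" "Suc n"], of c]
    by (simp add: mult.commute flip: scaleR_2)
  show "has_mixed_moment M (\<lambda>\<omega>. c *\<^sub>R (\<xi> n \<omega> + \<xi> (Suc n) \<omega>))
      (\<lambda>\<omega>. c *\<^sub>R (\<xi> (Suc n) \<omega> + \<xi> (Suc (Suc n)) \<omega>)) (c\<^sup>2 *\<^sub>R mat 1)"
    using has_mixed_moment_scaled_sums[OF m[of n "Suc n"] m[of n "Suc (Suc n)"]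
        m[of "Suc n" "Suc n"] m[of "Suc n" "Suc (Suc n)"], of c]
    by simp
qed

section \<open>Independence\<close>

text \<open>This joins a variable that is independent of a whole family to that family. Given finitely many
  events, those that belong to the family define a single event of the product space \<open>Pi\<^sub>M I N\<close>,
  to which the assumed independence of two variables applies; the independence of the family then
  splits its probability further.\<close>

lemma (in prob_space) indep_vars_insert:
  assumes indep: "indep_vars N X I" and i: "i \<notin> I"
    and indep_i: "indep_var (Pi\<^sub>M {i} N) (\<lambda>\<omega>. \<lambda>j\<in>{i}. X j \<omega>) (Pi\<^sub>M I N) (\<lambda>\<omega>. \<lambda>j\<in>I. X j \<omega>)"
  shows "indep_vars N X (insert i I)"
proof -
  have rv_I: "X j \<in> measurable M (N j)" if "j \<in> I" for j
    using indep that by (simp add: indep_vars_def)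
  have "(\<lambda>\<omega>. (\<lambda>j\<in>{i}. X j \<omega>) i) \<in> measurable M (N i)"
    by (rule measurable_compose[OF indep_var_rv1[OF indep_i] measurable_component_singleton]) simp
  then have rv_i: "X i \<in> measurable M (N i)" by simp
  have rv: "X j \<in> measurable M (N j)" if "j \<in> insert i I" for j
    using that rv_I rv_i by auto
  have factor: "prob (\<Inter>j\<in>J. X j -` A j \<inter> space M) = (\<Prod>j\<in>J. prob (X j -` A j \<inter> space M))"
    if J: "J \<noteq> {}" "J \<subseteq> insert i I" "finite J" and A: "\<And>j. j \<in> J \<Longrightarrow> A j \<in> sets (N j)" for J A
  proof (cases "i \<in> J")
    case False
    then show ?thesis
      using J A by (intro indep_varsD[OF indep]) auto
  next
    case True
    define K where "K = J - {i}"
    have K: "J = insert i K" "i \<notin> K" "K \<subseteq> I" "finite K"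
      using True J by (auto simp: K_def)
    show ?thesis
    proof (cases "K = {}")
      case False
      have KI: "j \<in> I" if "j \<in> K" for j
        using that K(3) by blast
      have coord: "{f \<in> space (Pi\<^sub>M L N). f j \<in> C} \<in> sets (Pi\<^sub>M L N)"
        if "j \<in> L" "C \<in> sets (N j)" for L j C
        using measurable_sets[OF measurable_component_singleton[OF that(1), of N] that(2)]
        by (simp add: vimage_def Int_def conj_commute)
      let ?E = "\<lambda>j. X j -` A j \<inter> space M"
      let ?B = "{f \<in> space (Pi\<^sub>M I N). \<forall>j\<in>K. f j \<in> A j}"
      let ?B' = "{f \<in> space (Pi\<^sub>M {i} N). f i \<in> A i}"
      have B: "?B \<in> sets (Pi\<^sub>M I N)" "?B' \<in> sets (Pi\<^sub>M {i} N)"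
        using K False A by (auto intro!: sets.sets_Collect_finite_All' coord)
      have "prob (\<Inter>j\<in>J. ?E j) = prob ((\<lambda>\<omega>. (\<lambda>j\<in>{i}. X j \<omega>, \<lambda>j\<in>I. X j \<omega>)) -` (?B' \<times> ?B) \<inter> space M)"
        using K False measurable_space[OF rv] by (intro arg_cong[where f=prob]) (auto simp: space_PiM KI)
      also have "\<dots> = prob ((\<lambda>\<omega>. \<lambda>j\<in>{i}. X j \<omega>) -` ?B' \<inter> space M) * prob ((\<lambda>\<omega>. \<lambda>j\<in>I. X j \<omega>) -` ?B \<inter> space M)"
        using indep_i B(2,1) by (rule indep_varD)
      also have "(\<lambda>\<omega>. \<lambda>j\<in>{i}. X j \<omega>) -` ?B' \<inter> space M = ?E i"
        using measurable_space[OF rv] by (auto simp: space_PiM)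
      also have "(\<lambda>\<omega>. \<lambda>j\<in>I. X j \<omega>) -` ?B \<inter> space M = (\<Inter>j\<in>K. ?E j)"
        using K False measurable_space[OF rv] by (auto simp: space_PiM KI)
      also have "prob (\<Inter>j\<in>K. ?E j) = (\<Prod>j\<in>K. prob (?E j))"
        using K False A by (intro indep_varsD[OF indep]) auto
      finally show ?thesis
        using K by simp
    qed (simp add: K)
  qed
  show ?thesis
    unfolding indep_vars_def2
  proof (intro conjI ballI indep_setsI)
    fix E J assume J: "J \<noteq> {}" "J \<subseteq> insert i I" "finite J"
      and "\<forall>j\<in>J. E j \<in> {X j -` A \<inter> space M |A. A \<in> sets (N j)}"
    then have "\<forall>j\<in>J. \<exists>A. E j = X j -` A \<inter> space M \<and> A \<in> sets (N j)"
      by simp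
    then obtain A where A: "\<And>j. j \<in> J \<Longrightarrow> A j \<in> sets (N j)"
        "\<And>j. j \<in> J \<Longrightarrow> E j = X j -` A j \<inter> space M"
      by metis
    then show "prob (\<Inter>j\<in>J. E j) = (\<Prod>j\<in>J. prob (E j))"
      using factor[OF J, of A] by simp
  qed (use rv in auto)
qed

lemma (in prob_space) indep_var_cong_space:
  assumes "\<And>\<omega>. \<omega> \<in> space M \<Longrightarrow> X \<omega> = X' \<omega>" "\<And>\<omega>. \<omega> \<in> space M \<Longrightarrow> Y \<omega> = Y' \<omega>"
  shows "indep_var S X T Y \<longleftrightarrow> indep_var S X' T Y'"
proof -
  have "X -` A \<inter> space M = X' -` A \<inter> space M" "Y -` B \<inter> space M = Y' -` B \<inter> space M" for A B
    using assms by auto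
  moreover have "X \<in> measurable M S \<longleftrightarrow> X' \<in> measurable M S" "Y \<in> measurable M T \<longleftrightarrow> Y' \<in> measurable M T"
    by (intro measurable_cong assms; assumption)+
  ultimately show ?thesis
    unfolding indep_var_eq by simp
qed

section \<open>Moving averages of order one\<close>

text \<open>As \<open>0 - 1 = 0\<close> for natural numbers, this is an average of two consecutive entries from index 1 on.\<close>

definition moving_avg :: "real \<Rightarrow> (nat \<Rightarrow> real^'d) \<Rightarrow> nat \<Rightarrow> real^'d" where
  "moving_avg c x k = c *\<^sub>R (x (k - 1) + x k)"

text \<open>The past \<open>{1..k}\<close> and the future \<open>{k+2..}\<close> are functions of the noise with indices in the disjoint
  sets \<open>{..k}\<close> and \<open>{k+1..}\<close>; this is where the gap of one index is needed.\<close>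

lemma (in prob_space) one_dependent_moving_average:
  fixes \<xi> Y :: "nat \<Rightarrow> 'a \<Rightarrow> real^'d"
  assumes indep: "indep_vars (\<lambda>_. borel) \<xi> UNIV"
    and Y: "\<And>k \<omega>. k \<ge> 1 \<Longrightarrow> \<omega> \<in> space M \<Longrightarrow> Y k \<omega> = moving_avg c (\<lambda>i. \<xi> i \<omega>) k"
  shows "one_dependent_seq M Y"
  unfolding one_dependent_seq_def indep_families_def
proof (intro allI impI)
  fix k :: nat assume "k \<ge> 1"
  let ?T = "\<lambda>I f. \<lambda>j\<in>I. moving_avg c f j"
  have T: "?T I \<in> measurable (Pi\<^sub>M A (\<lambda>_. borel)) (Pi\<^sub>M I (\<lambda>_. borel))"
    if "\<And>j. j \<in> I \<Longrightarrow> j \<in> A \<and> j - 1 \<in> A" for I A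
    unfolding moving_avg_def
    using that by (intro measurable_restrict borel_measurable_scaleR borel_measurable_add
        measurable_component_singleton) auto
  have "indep_var (Pi\<^sub>M {..k} (\<lambda>_. borel)) (\<lambda>\<omega>. \<lambda>i\<in>{..k}. \<xi> i \<omega>)
      (Pi\<^sub>M {k+1..} (\<lambda>_. borel)) (\<lambda>\<omega>. \<lambda>i\<in>{k+1..}. \<xi> i \<omega>)"
    by (rule indep_var_restrict[OF indep]) auto
  then have "indep_var (Pi\<^sub>M {1..k} (\<lambda>_. borel)) (?T {1..k} \<circ> (\<lambda>\<omega>. \<lambda>i\<in>{..k}. \<xi> i \<omega>))
      (Pi\<^sub>M {k+2..} (\<lambda>_. borel)) (?T {k+2..} \<circ> (\<lambda>\<omega>. \<lambda>i\<in>{k+1..}. \<xi> i \<omega>))"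
    by (rule indep_var_compose) (rule T, auto)+
  moreover have "(?T {1..k} \<circ> (\<lambda>\<omega>. \<lambda>i\<in>{..k}. \<xi> i \<omega>)) \<omega> = (\<lambda>i\<in>{1..k}. Y i \<omega>)"
    "(?T {k+2..} \<circ> (\<lambda>\<omega>. \<lambda>i\<in>{k+1..}. \<xi> i \<omega>)) \<omega> = (\<lambda>i\<in>{k+2..}. Y i \<omega>)"
    if "\<omega> \<in> space M" for \<omega>
    using that by (auto simp: fun_eq_iff Y moving_avg_def restrict_def)
  ultimately show "indep_var (Pi\<^sub>M {1..k} (\<lambda>_. borel)) (\<lambda>\<omega>. \<lambda>i\<in>{1..k}. Y i \<omega>)
      (Pi\<^sub>M {k+2..} (\<lambda>_. borel)) (\<lambda>\<omega>. \<lambda>i\<in>{k+2..}. Y i \<omega>)"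
    by (subst (asm) indep_var_cong_space) auto
qed

text \<open>The joint law of independent, identically distributed variables is a power of their common law, which
  reindexing by a shift preserves. The shifted moving average is the same measurable function \<open>?T\<close> of
  the shifted noise and therefore has the same law as well.\<close>

lemma (in prob_space) stationary_moving_average:
  fixes \<xi> Y :: "nat \<Rightarrow> 'a \<Rightarrow> real^'d"
  assumes indep: "indep_vars (\<lambda>_. borel) \<xi> UNIV"
    and law: "\<And>i. distr M borel (\<xi> i) = D"
    and Y: "\<And>k \<omega>. k \<ge> 1 \<Longrightarrow> \<omega> \<in> space M \<Longrightarrow> Y k \<omega> = moving_avg c (\<lambda>i. \<xi> i \<omega>) k"
  shows "stationary_seq M Y"
proof -
  let ?P = "Pi\<^sub>M UNIV (\<lambda>_::nat. borel :: (real^'d) measure)"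
  have [measurable]: "\<xi> i \<in> borel_measurable M" for i
    using indep by (simp add: indep_vars_def)
  have D: "prob_space D" "sets D = sets borel"
    using prob_space_distr[of "\<xi> 0" borel] law[of 0] by auto
  have joint: "distr M ?P (\<lambda>\<omega> i. \<xi> i \<omega>) = Pi\<^sub>M UNIV (\<lambda>_. D)"
    using indep_vars_iff_distr_eq_PiM[where I=UNIV and M'="\<lambda>_. borel" and X=\<xi>] indep
    by (simp add: law restrict_def)
  have shift: "distr M ?P (\<lambda>\<omega> i. \<xi> (i + m) \<omega>) = Pi\<^sub>M UNIV (\<lambda>_. D)" for m
  proof -
    have "distr (Pi\<^sub>M UNIV (\<lambda>_. D)) (Pi\<^sub>M UNIV (\<lambda>_. D)) (\<lambda>f. \<lambda>i\<in>UNIV. f (i + m)) = Pi\<^sub>M UNIV (\<lambda>_. D)"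
      using distr_PiM_reindex[of UNIV "\<lambda>_. D" "\<lambda>i. i + m" UNIV] D by simp
    moreover have "distr (Pi\<^sub>M UNIV (\<lambda>_. D)) (Pi\<^sub>M UNIV (\<lambda>_. D)) (\<lambda>f. \<lambda>i\<in>UNIV. f (i + m))
        = distr (distr M ?P (\<lambda>\<omega> i. \<xi> i \<omega>)) ?P (\<lambda>f i. f (i + m))"
      unfolding joint restrict_UNIV by (intro distr_cong sets_PiM_cong refl D)
    moreover have "\<dots> = distr M ?P (\<lambda>\<omega> i. \<xi> (i + m) \<omega>)"
      by (subst distr_distr) (simp_all add: comp_def measurable_PiM_single')
    ultimately show ?thesis by simp
  qed
  let ?T = "\<lambda>f. \<lambda>k\<in>{1..}. moving_avg c f k"
  have T[measurable]: "?T \<in> measurable ?P (Pi\<^sub>M {1..} (\<lambda>_. borel))"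
    unfolding moving_avg_def by (intro measurable_restrict) simp
  have "distr M (Pi\<^sub>M {1..} (\<lambda>_. borel)) (\<lambda>\<omega>. \<lambda>k\<in>{1..}. Y (k + m) \<omega>)
      = distr (Pi\<^sub>M UNIV (\<lambda>_. D)) (Pi\<^sub>M {1..} (\<lambda>_. borel)) ?T" for m
  proof -
    have "distr M (Pi\<^sub>M {1..} (\<lambda>_. borel)) (\<lambda>\<omega>. \<lambda>k\<in>{1..}. Y (k + m) \<omega>)
        = distr M (Pi\<^sub>M {1..} (\<lambda>_. borel)) (?T \<circ> (\<lambda>\<omega> i. \<xi> (i + m) \<omega>))"
      by (intro distr_cong) (auto simp: fun_eq_iff Y moving_avg_def restrict_def)
    moreover have "distr (distr M ?P (\<lambda>\<omega> i. \<xi> (i + m) \<omega>)) (Pi\<^sub>M {1..} (\<lambda>_. borel)) ?T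
        = distr M (Pi\<^sub>M {1..} (\<lambda>_. borel)) (?T \<circ> (\<lambda>\<omega> i. \<xi> (i + m) \<omega>))"
      by (rule distr_distr[OF T]) (simp add: measurable_PiM_single')
    ultimately show ?thesis by (simp add: shift)
  qed
  note law_Y = this
  have "Y k \<in> borel_measurable M" if "k \<ge> 1" for k
  proof -
    have "Y k \<in> borel_measurable M \<longleftrightarrow> (\<lambda>\<omega>. c *\<^sub>R (\<xi> (k - 1) \<omega> + \<xi> k \<omega>)) \<in> borel_measurable M"
      using that by (intro measurable_cong) (simp add: Y moving_avg_def)
    then show ?thesis by simp
  qed
  then show ?thesis
    unfolding stationary_seq_def using law_Y law_Y[of 0] by simp
qed

text \<open>Collecting the two occurrences of every noise vector turns a linear functional of the moving average into a linear functional of the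
  noise, which is a sum of independent Gaussian variables; its coefficient at \<open>\<xi> i\<close> combines those of the
  entries \<open>i\<close> and \<open>i + 1\<close>.\<close>

lemma (in prob_space) gaussian_moving_average:
  fixes \<xi> Y :: "nat \<Rightarrow> 'a \<Rightarrow> real^'d"
  assumes indep: "indep_vars (\<lambda>_. borel) \<xi> UNIV" and gauss: "\<And>i. std_gaussian M (\<xi> i)"
    and Y: "\<And>k \<omega>. k \<ge> 1 \<Longrightarrow> \<omega> \<in> space M \<Longrightarrow> Y k \<omega> = moving_avg c (\<lambda>i. \<xi> i \<omega>) k"
  shows "gaussian_seq M Y"
  unfolding gaussian_seq_def
proof (intro allI impI)
  fix J :: "nat set" and a :: "nat \<Rightarrow> real^'d"
  assume J: "finite J \<and> J \<subseteq> {1..}"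
  then obtain n where n: "J \<subseteq> {..<Suc n}"
    using finite_nat_iff_bounded by (metis lessThan_subset_iff lessI less_imp_le order_trans)
  \<comment> \<open>Extending the coefficients by zero allows summation over an initial segment.\<close>
  define a' where "a' j = (if j \<in> J then a j else 0)" for j
  define b where "b i = c *\<^sub>R (a' (Suc i) + a' i)" for i
  have a'0: "a' 0 = 0" and a'n: "a' (Suc n) = 0"
    using J n by (auto simp: a'_def)
  have regroup: "(\<Sum>j\<in>J. a j \<bullet> Y j \<omega>) = (\<Sum>i<Suc n. b i \<bullet> \<xi> i \<omega>)" if "\<omega> \<in> space M" for \<omega>
  proof -
    have "(\<Sum>j\<in>J. a j \<bullet> Y j \<omega>) = (\<Sum>j\<in>J. a' j \<bullet> moving_avg c (\<lambda>i. \<xi> i \<omega>) j)"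
      using J that by (intro sum.cong) (auto simp: a'_def Y)
    also have "\<dots> = (\<Sum>j<Suc n. a' j \<bullet> moving_avg c (\<lambda>i. \<xi> i \<omega>) j)"
      using n by (intro sum.mono_neutral_left) (auto simp: a'_def)
    also have "\<dots> = (\<Sum>j<Suc n. c * (a' j \<bullet> \<xi> (j - 1) \<omega>)) + (\<Sum>j<Suc n. c * (a' j \<bullet> \<xi> j \<omega>))"
      by (simp add: moving_avg_def inner_add_right distrib_left sum.distrib)
    also have "(\<Sum>j<Suc n. c * (a' j \<bullet> \<xi> (j - 1) \<omega>)) = (\<Sum>i<n. c * (a' (Suc i) \<bullet> \<xi> i \<omega>))"
      unfolding sum.lessThan_Suc_shift by (simp add: a'0)
    also have "\<dots> = (\<Sum>i<Suc n. c * (a' (Suc i) \<bullet> \<xi> i \<omega>))"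
      by (simp add: a'n)
    finally show ?thesis
      by (simp add: b_def inner_add_left distrib_left sum.distrib)
  qed
  have G: "gaussian_rv M (\<lambda>\<omega>. \<Sum>i<Suc n. b i \<bullet> \<xi> i \<omega>)"
  proof (rule gaussian_rv_sum_indep)
    show "indep_vars (\<lambda>_. borel) (\<lambda>i \<omega>. b i \<bullet> \<xi> i \<omega>) {..<Suc n}"
      by (rule indep_vars_compose2[OF indep_vars_subset[OF indep]]) auto
  qed (auto intro: std_gaussian_inner_gaussian_rv gauss)
  have "(\<lambda>\<omega>. \<Sum>j\<in>J. a j \<bullet> Y j \<omega>) \<in> borel_measurable M
      \<longleftrightarrow> (\<lambda>\<omega>. \<Sum>i<Suc n. b i \<bullet> \<xi> i \<omega>) \<in> borel_measurable M"
    using regroup by (rule measurable_cong)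
  then show "gaussian_rv M (\<lambda>\<omega>. \<Sum>j\<in>J. a j \<bullet> Y j \<omega>)"
    using G by (intro gaussian_rv_cong_AE[OF G] AE_I2) (simp_all add: regroup gaussian_rv_def)
qed

theorem proposition6p2:
  fixes M :: "'w measure"
    and U :: "real^'d \<Rightarrow> real"
    and h \<gamma> \<beta> \<sigma> s :: real
    and \<xi> X V \<zeta> :: "nat \<Rightarrow> 'w \<Rightarrow> real^'d"
    and Xm1 :: "'w \<Rightarrow> real^'d"
  assumes "prob_space M"
    and "\<forall>x. U differentiable (at x)"
    and "strongly_convex U"
    and "\<exists>L. L-lipschitz_on UNIV (grad U)"
    and "h > 0" and "\<gamma> > 0"
    and "\<beta> = exp (- \<gamma> * h)"
    and "\<sigma> = sqrt (1 - \<beta>\<^sup>2)"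
    and "s = h\<^sup>2 / 2 * (1 + \<beta>)"
    and "baoab_chain M U h \<gamma> \<xi> X V"
    and "(std_gaussian M (\<xi> 0) \<and> indep_families M \<xi> {0} {1..}) \<or> (\<forall>\<omega>\<in>space M. \<xi> 0 \<omega> = 0)"
    and "\<forall>\<omega>\<in>space M.
           V 0 \<omega> = (2 * \<beta> / ((1 + \<beta>) * h)) *\<^sub>R (X 0 \<omega> - Xm1 \<omega>)
                   + (\<sigma> / (1 + \<beta>)) *\<^sub>R \<xi> 0 \<omega> - (h / 2) *\<^sub>R grad U (X 0 \<omega>)"
    and "\<forall>\<omega>\<in>space M. \<forall>k. \<zeta> (Suc k) \<omega> = (h / 2 * \<sigma>) *\<^sub>R (\<xi> k \<omega> + \<xi> (Suc k) \<omega>)"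
  shows "(\<forall>\<omega>\<in>space M. \<forall>k.
            X (Suc k) \<omega> = X k \<omega> + \<beta> *\<^sub>R (X k \<omega> - (case k of 0 \<Rightarrow> Xm1 \<omega> | Suc j \<Rightarrow> X j \<omega>))
                          - s *\<^sub>R grad U (X k \<omega>) + \<zeta> (Suc k) \<omega>)
       \<and> (std_gaussian M (\<xi> 0) \<and> indep_families M \<xi> {0} {1..} \<longrightarrow>
            centered_seq M \<zeta> \<and> stationary_seq M \<zeta> \<and> one_dependent_seq M \<zeta> \<and> gaussian_seq M \<zeta>
          \<and> (\<forall>k\<ge>1. has_mixed_moment M (\<zeta> k) (\<zeta> k) ((h\<^sup>2 / 2 * (1 - \<beta>\<^sup>2)) *\<^sub>R mat 1)
                  \<and> has_mixed_moment M (\<zeta> k) (\<zeta> (k + 1)) ((h\<^sup>2 / 4 * (1 - \<beta>\<^sup>2)) *\<^sub>R mat 1)))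
       \<and> ((\<forall>\<omega>\<in>space M. \<xi> 0 \<omega> = 0) \<longrightarrow>
            (\<forall>\<omega>\<in>space M. \<zeta> 1 \<omega> = (h / 2 * \<sigma>) *\<^sub>R \<xi> 1 \<omega>)
          \<and> has_covariance M (\<zeta> 1) ((h\<^sup>2 / 4 * (1 - \<beta>\<^sup>2)) *\<^sub>R mat 1)
          \<and> loewner_less ((h\<^sup>2 / 4 * (1 - \<beta>\<^sup>2)) *\<^sub>R mat 1 :: real^'d^'d)
                         ((h\<^sup>2 / 2 * (1 - \<beta>\<^sup>2)) *\<^sub>R mat 1)
          \<and> (\<forall>k\<ge>2. has_mixed_moment M (\<zeta> k) (\<zeta> k) ((h\<^sup>2 / 2 * (1 - \<beta>\<^sup>2)) *\<^sub>R mat 1)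
                  \<and> has_mixed_moment M (\<zeta> k) (\<zeta> (k + 1)) ((h\<^sup>2 / 4 * (1 - \<beta>\<^sup>2)) *\<^sub>R mat 1)))"
proof -
  interpret prob_space M by fact
  define c where "c = h / 2 * \<sigma>"
  have \<beta>: "0 < \<beta>" "\<beta> < 1"
    using assms(5-7) by simp_all
  then have "\<beta>\<^sup>2 < 1"
    by (simp add: power_less_one_iff)
  then have c2: "c\<^sup>2 = h\<^sup>2 / 4 * (1 - \<beta>\<^sup>2)"
    using assms(8) by (simp add: c_def power_mult_distrib power_divide)
  have gauss: "std_gaussian M (\<xi> k)" if "k \<ge> 1" for k
    using assms(10) that by (simp add: baoab_chain_def)
  have indep1: "indep_vars (\<lambda>_. borel) \<xi> {1..}"
    using assms(10) by (simp add: baoab_chain_def)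
  have \<zeta>: "\<zeta> (Suc k) \<omega> = c *\<^sub>R (\<xi> k \<omega> + \<xi> (Suc k) \<omega>)" if "\<omega> \<in> space M" for k \<omega>
    using assms(13) that by (simp add: c_def)

  have recursion: "X (Suc k) \<omega> = X k \<omega> + \<beta> *\<^sub>R (X k \<omega> - (case k of 0 \<Rightarrow> Xm1 \<omega> | Suc j \<Rightarrow> X j \<omega>))
      - s *\<^sub>R grad U (X k \<omega>) + \<zeta> (Suc k) \<omega>" if \<omega>: "\<omega> \<in> space M" for \<omega> k
  proof -
    have step: "(X (Suc k) \<omega>, V (Suc k) \<omega>) = baoab_step U h \<gamma> (\<xi> (Suc k) \<omega>) (X k \<omega>, V k \<omega>)" for k
      using assms(10) \<omega> by (simp add: baoab_chain_def)
    \<comment> \<open>For \<open>k = 0\<close> this is the definition of the auxiliary position, otherwise it comes from step \<open>k\<close>.\<close>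
    have "(h / 2 * (1 + \<beta>)) *\<^sub>R (V k \<omega> + (h / 2) *\<^sub>R grad U (X k \<omega>))
        = \<beta> *\<^sub>R (X k \<omega> - (case k of 0 \<Rightarrow> Xm1 \<omega> | Suc j \<Rightarrow> X j \<omega>)) + c *\<^sub>R \<xi> k \<omega>"
    proof (cases k)
      case 0
      have "V 0 \<omega> + (h / 2) *\<^sub>R grad U (X 0 \<omega>)
          = (2 * \<beta> / ((1 + \<beta>) * h)) *\<^sub>R (X 0 \<omega> - Xm1 \<omega>) + (\<sigma> / (1 + \<beta>)) *\<^sub>R \<xi> 0 \<omega>"
        using assms(12) \<omega> by simp
      moreover have "1 + \<beta> \<noteq> 0"
        using \<beta> by simp
      then have "h / 2 * (1 + \<beta>) * (2 * \<beta> / ((1 + \<beta>) * h)) = \<beta>"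
        "h / 2 * ((1 + \<beta>) * (\<sigma> / (1 + \<beta>))) = c"
        using assms(5) by (simp_all add: c_def)
      ultimately show ?thesis
        using 0 by (simp only: scaleR_add_right scaleR_scaleR nat.case mult.assoc)
    next
      case (Suc j)
      then show ?thesis
        using baoab_step_position_and_noise(2)[OF step[of j] assms(7-9)] by (simp add: c_def)
    qed
    then show ?thesis
      using baoab_step_position_and_noise(1)[OF step[of k] assms(7-9)]
      by (simp add: \<zeta>[OF \<omega>] scaleR_add_right c_def)
  qed

  \<comment> \<open>Stated from an index \<open>n\<close> on: \<open>n = 0\<close> serves the Gaussian \<open>\<xi> 0\<close>, and \<open>n = 1\<close> the vanishing one.\<close>
  have moments: "has_mixed_moment M (\<zeta> k) (\<zeta> k) ((h\<^sup>2 / 2 * (1 - \<beta>\<^sup>2)) *\<^sub>R mat 1)"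
    "has_mixed_moment M (\<zeta> k) (\<zeta> (k + 1)) ((h\<^sup>2 / 4 * (1 - \<beta>\<^sup>2)) *\<^sub>R mat 1)"
    if indep: "indep_vars (\<lambda>_. borel) \<xi> {n..}" and g: "\<And>i. i \<ge> n \<Longrightarrow> std_gaussian M (\<xi> i)"
      and k: "k \<ge> Suc n" for n k
  proof -
    obtain j where j: "k = Suc j" "j \<ge> n"
      using k by (cases k) auto
    have indep_j: "indep_vars (\<lambda>_. borel) \<xi> {j..}"
      using indep by (rule indep_vars_subset) (use j in auto)
    have "h\<^sup>2 / 2 * (1 - \<beta>\<^sup>2) = 2 * c\<^sup>2"
      by (simp add: c2)
    moreover note moving_average_mixed_moments[OF indep_j, of c]
    ultimately show "has_mixed_moment M (\<zeta> k) (\<zeta> k) ((h\<^sup>2 / 2 * (1 - \<beta>\<^sup>2)) *\<^sub>R mat 1)"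
      "has_mixed_moment M (\<zeta> k) (\<zeta> (k + 1)) ((h\<^sup>2 / 4 * (1 - \<beta>\<^sup>2)) *\<^sub>R mat 1)"
      using g j by (simp_all add: has_mixed_moment_cong[OF \<zeta> \<zeta>] flip: c2)
  qed

  have stationary_case: "centered_seq M \<zeta> \<and> stationary_seq M \<zeta> \<and> one_dependent_seq M \<zeta> \<and> gaussian_seq M \<zeta>
      \<and> (\<forall>k\<ge>1. has_mixed_moment M (\<zeta> k) (\<zeta> k) ((h\<^sup>2 / 2 * (1 - \<beta>\<^sup>2)) *\<^sub>R mat 1)
              \<and> has_mixed_moment M (\<zeta> k) (\<zeta> (k + 1)) ((h\<^sup>2 / 4 * (1 - \<beta>\<^sup>2)) *\<^sub>R mat 1))"
    if g0: "std_gaussian M (\<xi> 0)" and i0: "indep_families M \<xi> {0} {1..}"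
  proof -
    have g: "std_gaussian M (\<xi> k)" for k
      using g0 gauss by (cases k) auto
    have "indep_vars (\<lambda>_. borel) \<xi> (insert 0 {1..})"
      using i0 by (intro indep_vars_insert indep1) (simp_all add: indep_families_def)
    moreover have "insert 0 {1..} = (UNIV :: nat set)"
      by auto
    ultimately have indep: "indep_vars (\<lambda>_. borel) \<xi> UNIV"
      by simp
    have law: "distr M borel (\<xi> k) = distr M borel (\<xi> 0)" for k
      using g[of k] g[of 0] by (simp add: std_gaussian_def distributed_def cong: distr_cong)
    have Y: "\<zeta> k \<omega> = moving_avg c (\<lambda>i. \<xi> i \<omega>) k" if "k \<ge> 1" "\<omega> \<in> space M" for k \<omega>
      using that \<zeta>[of \<omega> "k - 1"] by (simp add: moving_avg_def)
    have "has_bochner_integral M (\<zeta> k) 0" if "k \<ge> 1" for k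
    proof -
      have "has_bochner_integral M (\<lambda>\<omega>. moving_avg c (\<lambda>i. \<xi> i \<omega>) k) (c *\<^sub>R (0 + 0))"
        unfolding moving_avg_def
        by (intro has_bochner_integral_scaleR_right has_bochner_integral_add std_gaussian_mean g)
      then show ?thesis
        using Y[OF that] by (simp cong: has_bochner_integral_cong)
    qed
    then have "centered_seq M \<zeta>"
      by (simp add: centered_seq_def)
    moreover have "indep_vars (\<lambda>_. borel) \<xi> {0..}"
      using indep by (simp add: atLeast_0)
    ultimately show ?thesis
      using stationary_moving_average[OF indep law Y] one_dependent_moving_average[OF indep Y]
        gaussian_moving_average[OF indep g Y] moments[of 0] g by auto
  qed

  have zero_case: "(\<forall>\<omega>\<in>space M. \<zeta> 1 \<omega> = (h / 2 * \<sigma>) *\<^sub>R \<xi> 1 \<omega>)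
      \<and> has_covariance M (\<zeta> 1) ((h\<^sup>2 / 4 * (1 - \<beta>\<^sup>2)) *\<^sub>R mat 1)"
    if z: "\<forall>\<omega>\<in>space M. \<xi> 0 \<omega> = 0"
  proof
    have \<zeta>1: "\<zeta> 1 \<omega> = c *\<^sub>R \<xi> 1 \<omega>" if "\<omega> \<in> space M" for \<omega>
      using \<zeta>[OF that, of 0] z that by simp
    then show "\<forall>\<omega>\<in>space M. \<zeta> 1 \<omega> = (h / 2 * \<sigma>) *\<^sub>R \<xi> 1 \<omega>"
      by (simp add: c_def)
    have "has_bochner_integral M (\<lambda>\<omega>. c *\<^sub>R \<xi> 1 \<omega>) (c *\<^sub>R 0)"
      by (intro has_bochner_integral_scaleR_right std_gaussian_mean gauss) simp
    then have mean: "has_bochner_integral M (\<zeta> 1) 0"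
      using \<zeta>1 by (simp cong: has_bochner_integral_cong)
    have "has_mixed_moment M (\<lambda>\<omega>. c *\<^sub>R \<xi> 1 \<omega>) (\<lambda>\<omega>. c *\<^sub>R \<xi> 1 \<omega>) (c\<^sup>2 *\<^sub>R mat 1)"
      using has_mixed_moment_scale[OF std_gaussian_second_moment[OF gauss[of 1]]] by simp
    then have "has_mixed_moment M (\<zeta> 1) (\<zeta> 1) (c\<^sup>2 *\<^sub>R mat 1)"
      by (subst has_mixed_moment_cong[OF \<zeta>1 \<zeta>1])
    then show "has_covariance M (\<zeta> 1) ((h\<^sup>2 / 4 * (1 - \<beta>\<^sup>2)) *\<^sub>R mat 1)"
      using mean by (simp add: has_covariance_def has_bochner_integral_iff c2)
  qed

  have "loewner_less ((h\<^sup>2 / 4 * (1 - \<beta>\<^sup>2)) *\<^sub>R mat 1 :: real^'d^'d) ((h\<^sup>2 / 2 * (1 - \<beta>\<^sup>2)) *\<^sub>R mat 1)"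
    using assms(5) \<open>\<beta>\<^sup>2 < 1\<close> by (intro loewner_less_scaled_identity) simp
  then show ?thesis
    using recursion stationary_case zero_case moments[OF indep1 gauss] by auto
qed

end
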